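(* Let $\beta\in(0,1)$ and $\alpha\in[-\beta,\beta]$. Let $\{m_n:n\in\mathbb{N}\}$ be a sequence of positive integers with $1\le m_n\le n$ for each $n\in\mathbb{N}$, $\lim_{n\to\infty}m_n=+\infty$, and, with $\gamma_n:=m_n/n$, $\lim_{n\to\infty}\gamma_n=\gamma\in[0,1]$. Let $\{T_n\}$ be the elephant random walk with stops in the triangular array setting with parameters $\alpha,\beta$ (defined in the context). Then $$\lim_{n\to\infty}\frac{T_n}{n}=0\quad\text{a.s.}$$ In addition, for $c\in(\max\{\alpha,1/2\},1)$, $$\lim_{n\to\infty}\frac{\gamma_nT_n}{(m_n)^c}=0\quad\text{a.s.}$$
   Context: Elephant random walk with stops. Let $s\in[0,1]$, $p,q\in[0,1)$, $r\in(0,1)$ with $p+q+r=1$, and put $\alpha:=p-q$, $\beta:=1-r$, so $\beta\in(0,1)$, $\alpha\in[-\beta,\beta]$. Let $X_1=+1$ with probability $s$ and $X_1=-1$ with probability $1-s$. Let $\{U_n:n\ge1\}$ be independent random variables, independent of $X_1$, with $U_n$ uniform on $\{1,\dots,n\}$, and for $n\in\mathbb{N}=\{1,2,\dots\}$ let $X_{n+1}=X_{U_n}$ with probability $p$, $X_{n+1}=-X_{U_n}$ with probability $q$, and $X_{n+1}=0$ with probability $r$ (these choices being independent of each other and of everything else). Triangular array setting. Given $\{m_n\}$ with $1\le m_n\le n$, for each $n$ and $1\le k\le n$ let $Y^{(n)}_k=X_k$ for $1\le k\le m_n$ and $Y^{(n)}_k=X^{(n)}_k$ for $m_n<k\le n$,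 where for $m_n<k\le n$, $X^{(n)}_k=X_{U_{k,n}}$ with probability $p$, $X^{(n)}_k=-X_{U_{k,n}}$ with probability $q$, and $X^{(n)}_k=0$ with probability $r$. Here $\mathcal{U}_n=\{U_{k,n}:m_n<k\le n\}$ is an i.i.d. collection of uniform random variables on $\{1,\dots,m_n\}$, and the collections $\mathcal{U}_n$, $n\in\mathbb{N}$, are independent (of each other and of $\{X_i\}$); the choices with probabilities $p,q,r$ are again independent of each other and of everything else. Define $T_n:=\sum_{k=1}^nY^{(n)}_k$. *)

theory Defs
  imports "HOL-Probability.Probability"
begin

text \<open>
  Index type for the sources of randomness: the first step, the uniform indices and the
  \<open>p\<close>/\<open>q\<close>/\<open>r\<close>-choices of the walk, and those of row \<open>n\<close>, position \<open>k\<close> of the triangular array.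
\<close>

datatype erw_source =
    Init
  | Pick nat
  | Choice nat
  | Row_Pick nat nat
  | Row_Choice nat nat

definition erw_sources :: "(nat \<Rightarrow> nat) \<Rightarrow> erw_source set" where
  "erw_sources m =
     {Init} \<union> {Pick n | n. 1 \<le> n} \<union> {Choice n | n. 1 \<le> n}
     \<union> {Row_Pick n k | n k. 1 \<le> n \<and> m n < k \<and> k \<le> n}
     \<union> {Row_Choice n k | n k. 1 \<le> n \<and> m n < k \<and> k \<le> n}"

text \<open>All sources as one integer-valued family, so that joint independence can be stated.\<close>

primrec erw_family ::
  "('a \<Rightarrow> int) \<Rightarrow> (nat \<Rightarrow> 'a \<Rightarrow> nat) \<Rightarrow> (nat \<Rightarrow> 'a \<Rightarrow> int) \<Rightarrow>
   (nat \<Rightarrow> nat \<Rightarrow> 'a \<Rightarrow> nat) \<Rightarrow> (nat \<Rightarrow> nat \<Rightarrow> 'a \<Rightarrow> int) \<Rightarrow> erw_source \<Rightarrow> 'a \<Rightarrow> int" where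
  "erw_family X1 U \<xi> V \<eta> Init = X1"
| "erw_family X1 U \<xi> V \<eta> (Pick n) = (\<lambda>\<omega>. int (U n \<omega>))"
| "erw_family X1 U \<xi> V \<eta> (Choice n) = \<xi> n"
| "erw_family X1 U \<xi> V \<eta> (Row_Pick n k) = (\<lambda>\<omega>. int (V n k \<omega>))"
| "erw_family X1 U \<xi> V \<eta> (Row_Choice n k) = \<eta> n k"

text \<open>
  \<open>X n\<close> is the \<open>n\<close>-th step of the walk and \<open>X' n k\<close> the step at position \<open>k\<close> of row \<open>n\<close> (only
  meaningful for \<open>m n < k \<le> n\<close>); index \<open>0\<close> is unused. ``Repeat, reverse or stop with probability
  \<open>p\<close>, \<open>q\<close>, \<open>r\<close>'' is multiplication of the remembered step by a choice variable (\<open>\<xi>\<close> or \<open>\<eta>\<close>) that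
  takes the values \<open>1\<close>, \<open>-1\<close>, \<open>0\<close> with these probabilities. The uniform indices are
  constrained through their law only, hence lie in the right range, and the recursions hold,
  almost surely.
\<close>

locale erw_stops_array = prob_space M
  for M :: "'a measure" +
  fixes s p q r :: real
    and m :: "nat \<Rightarrow> nat"
    and X :: "nat \<Rightarrow> 'a \<Rightarrow> int"
    and U :: "nat \<Rightarrow> 'a \<Rightarrow> nat"
    and \<xi> :: "nat \<Rightarrow> 'a \<Rightarrow> int"
    and X' :: "nat \<Rightarrow> nat \<Rightarrow> 'a \<Rightarrow> int"
    and V :: "nat \<Rightarrow> nat \<Rightarrow> 'a \<Rightarrow> nat"
    and \<eta> :: "nat \<Rightarrow> nat \<Rightarrow> 'a \<Rightarrow> int"
  assumes s: "0 \<le> s" "s \<le> 1"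
    and p: "0 \<le> p" "p < 1"
    and q: "0 \<le> q" "q < 1"
    and r: "0 < r" "r < 1"
    and pqr: "p + q + r = 1"
    and m: "\<And>n. 1 \<le> n \<Longrightarrow> 1 \<le> m n \<and> m n \<le> n"
    and measurable_X: "\<And>n. 1 \<le> n \<Longrightarrow> X n \<in> M \<rightarrow>\<^sub>M count_space UNIV"
    and measurable_U: "\<And>n. 1 \<le> n \<Longrightarrow> U n \<in> M \<rightarrow>\<^sub>M count_space UNIV"
    and measurable_X': "\<And>n k. 1 \<le> n \<Longrightarrow> m n < k \<Longrightarrow> k \<le> n \<Longrightarrow> X' n k \<in> M \<rightarrow>\<^sub>M count_space UNIV"
    and measurable_V: "\<And>n k. 1 \<le> n \<Longrightarrow> m n < k \<Longrightarrow> k \<le> n \<Longrightarrow> V n k \<in> M \<rightarrow>\<^sub>M count_space UNIV"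
    and indep: "indep_vars (\<lambda>_. count_space UNIV) (erw_family (X 1) U \<xi> V \<eta>) (erw_sources m)"
    and law_X1:
      "prob {\<omega> \<in> space M. X 1 \<omega> = 1} = s"
      "prob {\<omega> \<in> space M. X 1 \<omega> = - 1} = 1 - s"
    and law_U: "\<And>n. 1 \<le> n \<Longrightarrow>
      distr M (count_space UNIV) (U n) = measure_pmf (pmf_of_set {1..n})"
    and law_\<xi>:
      "\<And>n. 1 \<le> n \<Longrightarrow> prob {\<omega> \<in> space M. \<xi> n \<omega> = 1} = p"
      "\<And>n. 1 \<le> n \<Longrightarrow> prob {\<omega> \<in> space M. \<xi> n \<omega> = - 1} = q"
      "\<And>n. 1 \<le> n \<Longrightarrow> prob {\<omega> \<in> space M. \<xi> n \<omega> = 0} = r"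
    and law_V: "\<And>n k. 1 \<le> n \<Longrightarrow> m n < k \<Longrightarrow> k \<le> n \<Longrightarrow>
      distr M (count_space UNIV) (V n k) = measure_pmf (pmf_of_set {1..m n})"
    and law_\<eta>:
      "\<And>n k. 1 \<le> n \<Longrightarrow> m n < k \<Longrightarrow> k \<le> n \<Longrightarrow> prob {\<omega> \<in> space M. \<eta> n k \<omega> = 1} = p"
      "\<And>n k. 1 \<le> n \<Longrightarrow> m n < k \<Longrightarrow> k \<le> n \<Longrightarrow> prob {\<omega> \<in> space M. \<eta> n k \<omega> = - 1} = q"
      "\<And>n k. 1 \<le> n \<Longrightarrow> m n < k \<Longrightarrow> k \<le> n \<Longrightarrow> prob {\<omega> \<in> space M. \<eta> n k \<omega> = 0} = r"
    and step_X: "\<And>n. 1 \<le> n \<Longrightarrow> AE \<omega> in M. X (n + 1) \<omega> = \<xi> n \<omega> * X (U n \<omega>) \<omega>"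
    and step_X': "\<And>n k. 1 \<le> n \<Longrightarrow> m n < k \<Longrightarrow> k \<le> n \<Longrightarrow>
      AE \<omega> in M. X' n k \<omega> = \<eta> n k \<omega> * X (V n k \<omega>) \<omega>"

definition array_step ::
  "(nat \<Rightarrow> nat) \<Rightarrow> (nat \<Rightarrow> 'a \<Rightarrow> int) \<Rightarrow> (nat \<Rightarrow> nat \<Rightarrow> 'a \<Rightarrow> int) \<Rightarrow> nat \<Rightarrow> nat \<Rightarrow> 'a \<Rightarrow> int" where
  "array_step m X X' n k \<omega> = (if k \<le> m n then X k \<omega> else X' n k \<omega>)"

definition array_walk ::
  "(nat \<Rightarrow> nat) \<Rightarrow> (nat \<Rightarrow> 'a \<Rightarrow> int) \<Rightarrow> (nat \<Rightarrow> nat \<Rightarrow> 'a \<Rightarrow> int) \<Rightarrow> nat \<Rightarrow> 'a \<Rightarrow> int" where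
  "array_walk m X X' n \<omega> = (\<Sum>k=1..n. array_step m X X' n k \<omega>)"

end

theory Submission
  imports Defs "HOL-Real_Asymp.Real_Asymp"
begin

text \<open>
  Write \<open>S n\<close> for the position of the walk, \<open>T n\<close> for the array walk, \<open>a = p - q\<close> and
  \<open>\<gamma> n = m n / n\<close>. Given the first \<open>n\<close> steps, the next step lies in \<open>[-1, 1]\<close> and has mean
  \<open>a * S n / n\<close>; given the first \<open>m n\<close> steps, each row step lies in \<open>[-1, 1]\<close> and has mean
  \<open>a * S (m n) / m n\<close>. Hence \<open>T n\<close> is \<open>(1 + a * (n - m n) / m n) * S (m n)\<close> plus a
  fluctuation \<open>D n\<close> of the row (\<open>array_walk_AE\<close>), and the two parts are controlled separately.

  Both are handled by exponential moments. Hoeffding's lemma, applied conditionally on the past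
  (\<open>exp_moment_memory_step\<close>), bounds the exponential moment of \<open>S (n + 1)\<close> at \<open>l\<close> by
  \<open>exp (l\<^sup>2 / 2)\<close> times that of \<open>S n\<close> at \<open>l * (1 + a / n)\<close>. Iterating this,
  \<open>S n\<close> is sub-Gaussian with a variance proxy \<open>v n\<close> that satisfies
  \<open>v (n + 1) = 1 + (1 + a / n)\<^sup>2 * v n\<close>, which is of order at most \<open>n powr (2 * d)\<close> for every
  \<open>d > max a (1 / 2)\<close> (\<open>walk_subgaussian\<close>, \<open>walk_var_le_powr\<close>). For \<open>c > d\<close> the Chernoff
  bounds for \<open>S n / n powr c\<close> are summable, so \<open>S n / n powr c\<close> tends to \<open>0\<close> almost surely, and hence
  so does \<open>S (m n) / m n powr c\<close>. Its coefficient in \<open>\<gamma> n * T n / m n powr c\<close> is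
  \<open>\<gamma> n + a * (1 - \<gamma> n)\<close>, which is at most \<open>1\<close> in absolute value.

  In the same way \<open>D n\<close> is sub-Gaussian with variance proxy \<open>n - m n\<close> (\<open>row_dev_subgaussian\<close>). Its
  normalisation \<open>n * m n powr (c - 1)\<close> is at least \<open>n powr c\<close>, so that the Chernoff bounds are summable
  in \<open>n\<close> as soon as \<open>c > 1 / 2\<close>, no matter how slowly \<open>m n\<close> grows. This proves the second claim. The first
  one follows from it, since \<open>T n / n\<close> is \<open>\<gamma> n * T n / m n powr c\<close> times
  \<open>m n powr (c - 1) \<le> 1\<close>, and an admissible \<open>c < 1\<close> exists because \<open>a \<le> \<beta> < 1\<close>.
\<close>

section \<open>Hoeffding's lemma and sub-Gaussian variables\<close>

text \<open>
  Hoeffding's lemma for a finitely supported law on \<open>[-1, 1]\<close>. Convexity of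
  \<open>exp\<close> reduces it to the two-point law on \<open>{-1, 1}\<close> with the same mean, where it is the calculus
  inequality \<open>Hoeffdings_lemma_aux\<close> with \<open>h = 2 l\<close>; negative \<open>l\<close> follow by reflecting \<open>y\<close>.
\<close>

lemma finite_hoeffding:
  fixes w y :: "'i \<Rightarrow> real" and l :: real
  assumes I: "finite I" and w: "\<And>i. i \<in> I \<Longrightarrow> 0 \<le> w i" "sum w I = 1"
    and y: "\<And>i. i \<in> I \<Longrightarrow> \<bar>y i\<bar> \<le> 1"
  shows "(\<Sum>i\<in>I. w i * exp (l * y i)) \<le> exp (l * (\<Sum>i\<in>I. w i * y i) + l\<^sup>2 / 2)"
proof -
  have pos: "(\<Sum>i\<in>I. w i * exp (l * y i)) \<le> exp (l * (\<Sum>i\<in>I. w i * y i) + l\<^sup>2 / 2)"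
    if l: "0 \<le> l" and y: "\<And>i. i \<in> I \<Longrightarrow> \<bar>y i\<bar> \<le> 1" for l and y :: "'i \<Rightarrow> real"
  proof -
    define \<mu> where "\<mu> = (\<Sum>i\<in>I. w i * y i)"
    \<comment> \<open>the mass at \<open>1\<close> of the two-point law on \<open>{-1, 1}\<close> with mean \<open>\<mu>\<close>\<close>
    define P where "P = (1 + \<mu>) / 2"
    have chord: "exp (l * t) \<le> exp (- l) * (1 + (1 + t) / 2 * (exp (2 * l) - 1))" if "\<bar>t\<bar> \<le> 1" for t
    proof -
      have "exp (l * ((1 - (1 + t) / 2) * (- 1) + (1 + t) / 2 * 1))
          \<le> (1 - (1 + t) / 2) * exp (l * (- 1)) + (1 + t) / 2 * exp (l * 1)"
        using convex_onD[OF convex_on_exp[OF l], of "(1 + t) / 2" "- 1" 1] that by auto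
      moreover have "exp l = exp (- l) * exp (2 * l)"
        by (simp flip: exp_add)
      ultimately show ?thesis by (simp add: field_simps)
    qed
    have "- 1 \<le> \<mu>"
    proof -
      have "(\<Sum>i\<in>I. w i * (- 1)) \<le> \<mu>"
        unfolding \<mu>_def using w y by (intro sum_mono mult_left_mono) (auto simp: abs_le_iff)
      then show ?thesis using w by (simp add: sum_negf)
    qed
    then have P: "0 \<le> P" by (simp add: P_def)
    have "(\<Sum>i\<in>I. w i * exp (l * y i))
        \<le> (\<Sum>i\<in>I. w i * (exp (- l) * (1 + (1 + y i) / 2 * (exp (2 * l) - 1))))"
      using w y by (intro sum_mono mult_left_mono chord) auto
    also have "\<dots> = (\<Sum>i\<in>I. exp (- l) * (w i + (w i + w i * y i) / 2 * (exp (2 * l) - 1)))"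
      by (intro sum.cong refl) (simp add: field_simps)
    also have "\<dots> = exp (- l) * (1 + P * (exp (2 * l) - 1))"
      by (simp add: sum_distrib_left[symmetric] sum_distrib_right[symmetric] sum.distrib w
          sum_divide_distrib[symmetric] P_def \<mu>_def)
    also have "\<dots> \<le> exp (- l) * exp (2 * l * P + (2 * l)\<^sup>2 / 8)"
    proof -
      have "0 < 1 + P * (exp (2 * l) - 1)"
        using P l by (intro add_pos_nonneg mult_nonneg_nonneg) auto
      moreover have "ln (1 + P * (exp (2 * l) - 1)) \<le> 2 * l * P + (2 * l)\<^sup>2 / 8"
        using Hoeffdings_lemma_aux[of "2 * l" P] l P by simp
      ultimately show ?thesis by (metis exp_le_cancel_iff exp_ln mult_le_cancel_left_pos exp_gt_zero)
    qed
    also have "\<dots> = exp (l * \<mu> + l\<^sup>2 / 2)"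
      by (simp add: P_def power2_eq_square algebra_simps flip: exp_add)
    finally show ?thesis unfolding \<mu>_def .
  qed
  show ?thesis
  proof (cases "0 \<le> l")
    case True
    then show ?thesis using pos y by blast
  next
    case False
    then show ?thesis using pos[of "- l" "\<lambda>i. - y i"] y by (simp add: sum_negf)
  qed
qed

context prob_space
begin

text \<open>
  The factor \<open>C\<close> makes room for variables that are not centred: the first step of the walk has mean
  \<open>2 s - 1\<close>, which in general leaves a bias in all later positions.
\<close>

definition subgaussian :: "real \<Rightarrow> real \<Rightarrow> ('a \<Rightarrow> real) \<Rightarrow> bool" where
  "subgaussian C v Z \<longleftrightarrow> random_variable borel Z \<and>
     (\<forall>l. integrable M (\<lambda>\<omega>. exp (l * Z \<omega>)) \<and> expectation (\<lambda>\<omega>. exp (l * Z \<omega>)) \<le> C * exp (l\<^sup>2 * v / 2))"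

lemma subgaussian_tail:
  assumes Z: "subgaussian C v Z" and v: "0 < v" and t: "0 < t"
  shows "prob {\<omega> \<in> space M. t \<le> \<bar>Z \<omega>\<bar>} \<le> 2 * C * exp (- (t\<^sup>2 / (2 * v)))"
proof -
  have [measurable]: "random_variable borel Z" using Z by (simp add: subgaussian_def)
  \<comment> \<open>minimises the exponent \<open>l\<^sup>2 v / 2 - l t\<close> of the Chernoff bound\<close>
  define l where "l = t / v"
  have l: "0 < l" using v t by (simp add: l_def)
  have bound: "prob {\<omega> \<in> space M. t \<le> \<sigma> * Z \<omega>} \<le> C * exp (- (t\<^sup>2 / (2 * v)))"
    if \<sigma>: "\<sigma>\<^sup>2 = 1" for \<sigma>
  proof -
    have int: "integrable M (\<lambda>\<omega>. exp (l * (\<sigma> * Z \<omega>)))"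
      and le: "expectation (\<lambda>\<omega>. exp (l * (\<sigma> * Z \<omega>))) \<le> C * exp (l\<^sup>2 * v / 2)"
      using Z \<sigma> by (auto simp: subgaussian_def power_mult_distrib mult.assoc[symmetric] dest!: spec[of _ "l * \<sigma>"])
    have "set_integrable M (space M) (\<lambda>\<omega>. exp (l * (\<sigma> * Z \<omega>)))"
      unfolding set_integrable_def using int by (rule integrable_mult_indicator[rotated]) simp
    then have "prob {\<omega> \<in> space M. \<sigma> * Z \<omega> \<ge> t}
        \<le> exp (- l * t) * (\<integral>\<omega>\<in>space M. exp (l * (\<sigma> * Z \<omega>)) \<partial>M)"
      by (intro Chernoff_ineq_ge l) auto
    also have "(\<integral>\<omega>\<in>space M. exp (l * (\<sigma> * Z \<omega>)) \<partial>M) = expectation (\<lambda>\<omega>. exp (l * (\<sigma> * Z \<omega>)))"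
      using int by (simp add: set_integral_space)
    also have "exp (- l * t) * \<dots> \<le> exp (- l * t) * (C * exp (l\<^sup>2 * v / 2))"
      using le by (intro mult_left_mono) auto
    also have "\<dots> = C * exp (- l * t + l\<^sup>2 * v / 2)" by (simp only: exp_add mult_ac)
    also have "- l * t + l\<^sup>2 * v / 2 = - (t\<^sup>2 / (2 * v))"
      using v by (simp add: l_def field_simps power2_eq_square)
    finally show ?thesis .
  qed
  have "prob {\<omega> \<in> space M. t \<le> \<bar>Z \<omega>\<bar>}
      \<le> prob ({\<omega> \<in> space M. t \<le> 1 * Z \<omega>} \<union> {\<omega> \<in> space M. t \<le> - 1 * Z \<omega>})"
    by (intro finite_measure_mono) auto
  also have "\<dots> \<le> prob {\<omega> \<in> space M. t \<le> 1 * Z \<omega>} + prob {\<omega> \<in> space M. t \<le> - 1 * Z \<omega>}"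
    by (intro measure_Un_le) measurable
  also have "\<dots> \<le> C * exp (- (t\<^sup>2 / (2 * v))) + C * exp (- (t\<^sup>2 / (2 * v)))"
    by (intro add_mono bound) auto
  finally show ?thesis by simp
qed

text \<open>
  When the variance proxies are polynomially smaller than \<open>(b n)\<^sup>2\<close>, the Chernoff bounds
  \<open>exp (- \<delta> n powr \<kappa>)\<close> are summable for every \<open>\<kappa> > 0\<close>, however small, and the
  Borel-Cantelli lemma applies. Second moments would give
  summability only for \<open>\<kappa> > 1\<close>.
\<close>

lemma subgaussian_AE_tendsto_0:
  assumes Z: "\<And>n. 1 \<le> n \<Longrightarrow> subgaussian C (v n) (Z n)"
    and v: "\<And>n. 1 \<le> n \<Longrightarrow> 0 < v n" and b: "\<And>n. 1 \<le> n \<Longrightarrow> 0 < b n"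
    and \<kappa>: "0 < \<kappa>" and K: "0 < K" and vb: "\<And>n. 1 \<le> n \<Longrightarrow> real n powr \<kappa> * v n \<le> K * (b n)\<^sup>2"
  shows "AE \<omega> in M. (\<lambda>n. Z n \<omega> / b n) \<longlonglongrightarrow> 0"
proof -
  have C: "0 \<le> C"
  proof -
    have "expectation (\<lambda>\<omega>. exp (0 * Z 1 \<omega>)) \<le> C * exp (0\<^sup>2 * v 1 / 2)"
      using Z[of 1] unfolding subgaussian_def by blast
    then show ?thesis by (simp add: prob_space)
  qed
  have ev: "AE \<omega> in M. \<forall>\<^sub>F n in sequentially. \<bar>Z (Suc n) \<omega>\<bar> / b (Suc n) < \<epsilon>" if \<epsilon>: "0 < \<epsilon>" for \<epsilon>
  proof -
    \<comment> \<open>the hypotheses start at index \<open>1\<close>, hence the shift by \<open>Suc\<close>\<close>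
    define A where "A n = {\<omega> \<in> space M. \<epsilon> * b (Suc n) \<le> \<bar>Z (Suc n) \<omega>\<bar>}" for n
    define \<delta> where "\<delta> = \<epsilon>\<^sup>2 / (2 * K)"
    have \<delta>: "0 < \<delta>" using \<epsilon> K by (simp add: \<delta>_def)
    have [measurable]: "random_variable borel (Z (Suc n))" for n
      using Z[of "Suc n"] by (simp add: subgaussian_def)
    have meas: "A n \<in> sets M" for n unfolding A_def by measurable
    have prob: "prob (A n) \<le> 2 * C * exp (- \<delta> * real (Suc n) powr \<kappa>)" for n
    proof -
      have "prob (A n) \<le> 2 * C * exp (- ((\<epsilon> * b (Suc n))\<^sup>2 / (2 * v (Suc n))))"
        unfolding A_def using \<epsilon> by (intro subgaussian_tail Z v mult_pos_pos b) auto
      also have "\<delta> * real (Suc n) powr \<kappa> \<le> (\<epsilon> * b (Suc n))\<^sup>2 / (2 * v (Suc n))"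
      proof -
        have "\<epsilon>\<^sup>2 * (real (Suc n) powr \<kappa> * v (Suc n)) \<le> \<epsilon>\<^sup>2 * (K * (b (Suc n))\<^sup>2)"
          by (intro mult_left_mono vb) auto
        then show ?thesis using v[of "Suc n"] K
          by (simp add: \<delta>_def field_simps power_mult_distrib)
      qed
      then have "2 * C * exp (- ((\<epsilon> * b (Suc n))\<^sup>2 / (2 * v (Suc n))))
          \<le> 2 * C * exp (- \<delta> * real (Suc n) powr \<kappa>)"
        using C by (intro mult_left_mono) auto
      finally show ?thesis .
    qed
    have "summable (\<lambda>n. exp (- \<delta> * real (Suc n) powr \<kappa>))"
    proof (rule summable_comparison_test_bigo)
      show "summable (\<lambda>n. norm (1 / real (Suc n) ^ 2))"
        using inverse_power_summable[of 2, where 'a = real]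
        by (subst summable_Suc_iff[where f="\<lambda>n. norm (1 / real n ^ 2)"]) (simp add: inverse_eq_divide)
      show "(\<lambda>n. exp (- \<delta> * real (Suc n) powr \<kappa>)) \<in> O(\<lambda>n. 1 / real (Suc n) ^ 2)"
        using \<delta> \<kappa> by real_asymp
    qed
    then have "summable (\<lambda>n. 2 * C * exp (- \<delta> * real (Suc n) powr \<kappa>))"
      by (rule summable_mult)
    then have "summable (\<lambda>n. prob (A n))"
    proof (rule summable_comparison_test')
      show "norm (prob (A n)) \<le> 2 * C * exp (- \<delta> * real (Suc n) powr \<kappa>)" for n
        unfolding real_norm_def abs_of_nonneg[OF measure_nonneg] by (rule prob)
    qed
    then have "AE \<omega> in M. \<forall>\<^sub>F n in sequentially. \<omega> \<in> space M - A n"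
      by (intro borel_cantelli_AE1 meas) (auto simp: emeasure_eq_measure)
    then show ?thesis
    proof eventually_elim
      case (elim \<omega>)
      then show ?case
        by eventually_elim (use b in \<open>auto simp: A_def not_le field_simps\<close>)
    qed
  qed
  have "AE \<omega> in M. \<forall>k. \<forall>\<^sub>F n in sequentially. \<bar>Z (Suc n) \<omega>\<bar> / b (Suc n) < 1 / real (Suc k)"
    by (subst AE_all_countable) (auto intro!: ev)
  then show ?thesis
  proof eventually_elim
    case (elim \<omega>)
    have "(\<lambda>n. Z (Suc n) \<omega> / b (Suc n)) \<longlonglongrightarrow> 0"
    proof (rule tendstoI)
      fix e :: real assume "0 < e"
      then obtain k where k: "1 / real (Suc k) < e" using nat_approx_posE by blast
      show "\<forall>\<^sub>F n in sequentially. dist (Z (Suc n) \<omega> / b (Suc n)) 0 < e"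
        using elim[rule_format, of k] by eventually_elim (use b k in \<open>auto simp: abs_divide abs_of_pos\<close>)
    qed
    then show ?case by (subst (asm) filterlim_sequentially_Suc)
  qed
qed

end

section \<open>Growth of the variance proxy\<close>

lemma Bernoulli_powr:
  fixes e y :: real
  assumes e: "1 \<le> e" and y: "0 \<le> y"
  shows "1 + e * y \<le> (1 + y) powr e"
proof -
  have pos: "0 < 1 + e * y" using e y by (intro add_pos_nonneg) auto
  have "(1 - 1 / e) * ln 1 + 1 / e * ln (1 + e * y) \<le> ln ((1 - 1 / e) *\<^sub>R 1 + (1 / e) *\<^sub>R (1 + e * y))"
    using e pos by (intro concave_onD[OF ln_concave]) auto
  also have "(1 - 1 / e) *\<^sub>R 1 + (1 / e) *\<^sub>R (1 + e * y) = 1 + y"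
    using e by (simp add: field_simps)
  finally have "ln (1 + e * y) \<le> e * ln (1 + y)"
    using e by (simp add: field_simps)
  then have "exp (ln (1 + e * y)) \<le> exp (e * ln (1 + y))" by simp
  then show ?thesis using pos y by (simp add: powr_def)
qed

text \<open>
  The variance proxy of the walk: given the first \<open>n\<close> steps, the exponential moment at \<open>l\<close> of the next
  position is governed by that of the present one at \<open>l * (1 + a / n)\<close>, and the new step contributes
  one unit. The convention \<open>a / 0 = 0\<close> gives the value \<open>1\<close> at \<open>n = 1\<close>.
\<close>

primrec walk_var :: "real \<Rightarrow> nat \<Rightarrow> real" where
  "walk_var a 0 = 0"
| "walk_var a (Suc n) = 1 + (1 + a / real n)\<^sup>2 * walk_var a n"

lemma walk_var_nonneg: "0 \<le> walk_var a n"
  by (induction n) auto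

lemma walk_var_pos: "1 \<le> n \<Longrightarrow> 0 < walk_var a n"
  by (cases n) (auto intro!: add_pos_nonneg mult_nonneg_nonneg walk_var_nonneg)

text \<open>
  The recursion multiplies by about \<open>1 + 2 a / n\<close> and adds \<open>1\<close>, whereas \<open>n powr (2 d)\<close> grows by a
  factor of at least \<open>1 + 2 d / n\<close>, by Bernoulli's inequality and \<open>2 d \<ge> 1\<close>. The surplus
  \<open>2 (d - a) / n\<close> absorbs both the square \<open>(a / n)\<^sup>2\<close>, once \<open>n\<close> is large, and the added \<open>1\<close>; the
  finitely many small \<open>n\<close> are absorbed into \<open>K\<close>.
\<close>

lemma walk_var_le_powr:
  assumes "a < d" "1 / 2 < d"
  shows "\<exists>K>0. \<forall>n\<ge>1. walk_var a n \<le> K * real n powr (2 * d)"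
proof -
  obtain N :: nat where N: "a\<^sup>2 / (d - a) \<le> real N" using real_arch_simple by blast
  define K where "K = Max ((\<lambda>n. walk_var a n) ` {..Suc N}) + 1 / (d - a)"
  have Max_ge: "walk_var a n \<le> Max ((\<lambda>n. walk_var a n) ` {..Suc N})" if "n \<le> Suc N" for n
    using that by (intro Max_ge) auto
  have "0 \<le> Max ((\<lambda>n. walk_var a n) ` {..Suc N})" using Max_ge[of 0] by simp
  then have K: "0 < K" "1 / (d - a) \<le> K" using assms by (auto simp: K_def intro: add_nonneg_pos)
  have "walk_var a n \<le> K * real n powr (2 * d)" if "1 \<le> n" for n
    using that
  proof (induction n rule: nat_induct_at_least)
    case base
    show ?case using Max_ge[of 1] assms by (simp add: K_def add.commute add_increasing)
  next
    case (Suc n)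
    show ?case
    proof (cases "n \<le> N")
      case True
      have "walk_var a (Suc n) \<le> K"
        using Max_ge[of "Suc n"] True assms by (simp add: K_def add_increasing2)
      also have "\<dots> \<le> K * real (Suc n) powr (2 * d)"
        using K assms ge_one_powr_ge_zero[of "real (Suc n)" "2 * d"] by simp
      finally show ?thesis .
    next
      case False
      define x where "x = real n"
      have x: "1 \<le> x" "a\<^sup>2 / (d - a) \<le> x" using Suc.hyps False N by (auto simp: x_def)
      have quad: "a\<^sup>2 / x\<^sup>2 \<le> (d - a) / x"
        using x assms by (simp add: field_simps power2_eq_square)
      have "1 \<le> K * x powr (2 * d) * ((d - a) / x)"
      proof -
        have "1 \<le> K * (d - a)" using K assms by (simp add: field_simps)
        also have "\<dots> \<le> K * (d - a) * x powr (2 * d - 1)"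
          using K assms x ge_one_powr_ge_zero[of x "2 * d - 1"] by simp
        also have "\<dots> = K * x powr (2 * d) * ((d - a) / x)"
          using x by (simp add: powr_diff)
        finally show ?thesis .
      qed
      moreover have "(1 + a / x)\<^sup>2 * walk_var a n \<le> (1 + a / x)\<^sup>2 * (K * x powr (2 * d))"
        using Suc.IH by (intro mult_left_mono) (auto simp: x_def)
      ultimately have "walk_var a (Suc n) \<le> K * x powr (2 * d) * ((d - a) / x + (1 + a / x)\<^sup>2)"
        by (simp add: x_def algebra_simps)
      also have "(d - a) / x + (1 + a / x)\<^sup>2 \<le> 1 + (2 * d) * (1 / x)"
        using quad by (simp add: power2_sum power_divide diff_divide_distrib)
      also have "\<dots> \<le> (1 + 1 / x) powr (2 * d)"
        using assms x by (intro Bernoulli_powr) auto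
      also have "K * x powr (2 * d) * (1 + 1 / x) powr (2 * d) = K * real (Suc n) powr (2 * d)"
      proof -
        have "x * (1 + 1 / x) = real (Suc n)" using x by (simp add: x_def field_simps)
        then show ?thesis using x by (simp add: powr_mult[symmetric] mult.assoc)
      qed
      finally show ?thesis using K by (simp add: mult_left_mono)
    qed
  qed
  then show ?thesis using K by blast
qed

section \<open>One step with memory\<close>

context prob_space
begin

lemma integrable_times_exp:
  fixes f Z :: "'a \<Rightarrow> real"
  assumes f: "integrable M f" and [measurable]: "random_variable borel Z" and B: "\<And>\<omega>. \<bar>Z \<omega>\<bar> \<le> B"
  shows "integrable M (\<lambda>\<omega>. f \<omega> * exp (l * Z \<omega>))"
proof (rule Bochner_Integration.integrable_bound)
  have [measurable]: "random_variable borel f" using f by auto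
  show "random_variable borel (\<lambda>\<omega>. f \<omega> * exp (l * Z \<omega>))" by measurable
  show "integrable M (\<lambda>\<omega>. f \<omega> * exp (\<bar>l\<bar> * B))" using f by simp
  have "l * Z \<omega> \<le> \<bar>l\<bar> * B" for \<omega>
  proof -
    have "l * Z \<omega> \<le> \<bar>l\<bar> * \<bar>Z \<omega>\<bar>" using abs_ge_self[of "l * Z \<omega>"] by (simp add: abs_mult)
    also have "\<dots> \<le> \<bar>l\<bar> * B" by (intro mult_left_mono B) auto
    finally show ?thesis .
  qed
  then show "AE \<omega> in M. norm (f \<omega> * exp (l * Z \<omega>)) \<le> norm (f \<omega> * exp (\<bar>l\<bar> * B))"
    by (intro AE_I2) (simp add: abs_mult mult_left_mono)
qed

lemma integrable_exp_bounded:
  fixes Z :: "'a \<Rightarrow> real"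
  assumes "random_variable borel Z" "\<And>\<omega>. \<bar>Z \<omega>\<bar> \<le> B"
  shows "integrable M (\<lambda>\<omega>. exp (l * Z \<omega>))"
  using integrable_times_exp[of "\<lambda>_. 1" Z B l] assms by simp

text \<open>
  Conditional Hoeffding bound for one step of a walk with memory, with the conditioning on the past
  \<open>G\<close> hidden in the weight \<open>f\<close>. Since \<open>(N, \<zeta>)\<close> takes finitely many values and is independent
  of \<open>G\<close>, the expectation splits into a finite sum over these values; for each \<open>\<omega>\<close> that sum is the
  exponential moment of a finite law on \<open>[-1, 1]\<close> with mean \<open>w 1 - w (-1)\<close> times the average of the
  remembered steps. The index is truncated by \<open>min n\<close> and the choice by \<open>sgn\<close>, so that bounds hold
  everywhere although the laws determine the ranges only almost surely.
\<close>

lemma exp_moment_memory_step: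
  fixes N :: "'a \<Rightarrow> nat" and \<zeta> :: "'a \<Rightarrow> int" and x :: "nat \<Rightarrow> 'a \<Rightarrow> real"
  assumes n: "1 \<le> n"
    and [measurable]: "random_variable (count_space UNIV) N" "random_variable (count_space UNIV) \<zeta>"
    and indep: "\<And>g j z. g \<in> borel_measurable G \<Longrightarrow>
      indep_var borel g borel (\<lambda>\<omega>. indicator {(j, z)} (N \<omega>, \<zeta> \<omega>) :: real)"
    and law: "\<And>j z. j \<in> {1..n} \<Longrightarrow> z \<in> {-1, 0, 1} \<Longrightarrow>
      prob {\<omega> \<in> space M. N \<omega> = j \<and> \<zeta> \<omega> = z} = w z / real n"
    and w: "\<And>z. z \<in> {-1, 0, 1} \<Longrightarrow> 0 \<le> w z" "w (-1) + w 0 + w 1 = 1"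
    and f[measurable]: "f \<in> borel_measurable G" "integrable M f" "\<And>\<omega>. 0 \<le> f \<omega>"
    and x: "\<And>j. j \<le> n \<Longrightarrow> x j \<in> borel_measurable G"
    and x_le: "\<And>j \<omega>. \<bar>x j \<omega>\<bar> \<le> 1"
  shows "expectation (\<lambda>\<omega>. f \<omega> * exp (l * (sgn (\<zeta> \<omega>) * x (min n (N \<omega>)) \<omega>)))
    \<le> exp (l\<^sup>2 / 2) * expectation (\<lambda>\<omega>. f \<omega> * exp (l * ((w 1 - w (-1)) * (\<Sum>j=1..n. x j \<omega>) / real n)))"
proof -
  define I where "I = {1..n} \<times> {-1, 0, 1 :: int}"
  define E where "E i = {\<omega> \<in> space M. N \<omega> = fst i \<and> \<zeta> \<omega> = snd i}" for i
  define g where "g i \<omega> = f \<omega> * exp (l * (snd i * x (fst i) \<omega>))" for i :: "nat \<times> int" and \<omega>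
  define W where "W i = w (snd i) / real n" for i :: "nat \<times> int"
  have I: "finite I" by (simp add: I_def)
  have sum_I: "(\<Sum>i\<in>I. h i) = (\<Sum>j=1..n. h (j, -1) + h (j, 0) + h (j, 1))" for h :: "nat \<times> int \<Rightarrow> real"
    by (simp add: I_def sum.cartesian_product[symmetric, of "\<lambda>j z. h (j, z)", simplified] add.assoc)
  have W0: "0 \<le> W i" if "i \<in> I" for i using that w by (auto simp: I_def W_def)
  have W1: "sum W I = 1"
  proof -
    have "sum W I = (\<Sum>j=1..n. (w (-1) + w 0 + w 1) / real n)"
      by (simp add: sum_I W_def add_divide_distrib)
    then show ?thesis using w n by simp
  qed
  have E[measurable]: "E i \<in> events" for i unfolding E_def by measurable
  have prob_E: "prob (E i) = W i" if "i \<in> I" for i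
    using that law[of "fst i" "snd i"] by (auto simp: I_def E_def W_def)
  have "prob (\<Union>i\<in>I. E i) = (\<Sum>i\<in>I. prob (E i))"
    by (intro finite_measure_finite_Union I) (auto simp: E_def disjoint_family_on_def)
  then have "prob (\<Union>i\<in>I. E i) = 1" using prob_E W1 by simp
  \<comment> \<open>the events \<open>E i\<close> are disjoint, and their probabilities add up to \<open>1\<close>\<close>
  then have AE_E: "AE \<omega> in M. \<omega> \<in> (\<Union>i\<in>I. E i)" by (rule AE_prob_1)
  have rv: "random_variable borel h" if "h \<in> borel_measurable G" for h :: "'a \<Rightarrow> real"
    using indep_var_rv1[OF indep[OF that]] .
  have gG: "g i \<in> borel_measurable G" if "i \<in> I" for i
    unfolding g_def using that by (intro borel_measurable_times f borel_measurable_exp[THEN measurable_compose[rotated]] x borel_measurable_const) (auto simp: I_def)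
  have g_int: "integrable M (g i)" if "i \<in> I" for i
    unfolding g_def
  proof (rule integrable_times_exp[where B = 1])
    show "random_variable borel (\<lambda>\<omega>. snd i * x (fst i) \<omega>)"
      using that by (intro rv borel_measurable_times x) (auto simp: I_def)
    show "\<bar>snd i * x (fst i) \<omega>\<bar> \<le> 1" for \<omega>
      using that x_le[of "fst i" \<omega>] by (auto simp: I_def)
  qed (rule f)
  have split: "integrable M (\<lambda>\<omega>. g i \<omega> * indicator (E i) \<omega>)"
      "expectation (\<lambda>\<omega>. g i \<omega> * indicator (E i) \<omega>) = W i * expectation (g i)" if "i \<in> I" for i
  proof -
    obtain j z where i: "i = (j, z)" by (cases i)
    have eq: "indicator {(j, z)} (N \<omega>, \<zeta> \<omega>) = (indicator (E i) \<omega> :: real)" if "\<omega> \<in> space M" for \<omega>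
      using that by (auto simp: i E_def indicator_def)
    have int: "integrable M (\<lambda>\<omega>. indicator {(j, z)} (N \<omega>, \<zeta> \<omega>) :: real)"
      using eq by (subst Bochner_Integration.integrable_cong[OF refl, where g = "indicator (E i)"])
        (auto simp: integrable_indicator_iff less_top[symmetric])
    note ind = indep[OF gG[OF that], of j z]
    show "integrable M (\<lambda>\<omega>. g i \<omega> * indicator (E i) \<omega>)"
      using indep_var_integrable[OF ind g_int[OF that] int] eq
      by (subst Bochner_Integration.integrable_cong[OF refl, where g = "\<lambda>\<omega>. g i \<omega> * indicator {(j, z)} (N \<omega>, \<zeta> \<omega>)"]) auto
    have "expectation (\<lambda>\<omega>. g i \<omega> * indicator (E i) \<omega>)
        = expectation (\<lambda>\<omega>. g i \<omega> * indicator {(j, z)} (N \<omega>, \<zeta> \<omega>))"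
      using eq by (intro Bochner_Integration.integral_cong) auto
    also have "\<dots> = expectation (g i) * expectation (\<lambda>\<omega>. indicator {(j, z)} (N \<omega>, \<zeta> \<omega>))"
      by (rule indep_var_lebesgue_integral[OF ind g_int[OF that] int])
    also have "expectation (\<lambda>\<omega>. indicator {(j, z)} (N \<omega>, \<zeta> \<omega>) :: real) = expectation (indicator (E i))"
      using eq by (intro Bochner_Integration.integral_cong) auto
    also have "\<dots> = W i" using prob_E[OF that] by simp
    finally show "expectation (\<lambda>\<omega>. g i \<omega> * indicator (E i) \<omega>) = W i * expectation (g i)"
      by (simp add: mult.commute)
  qed
  have x_meas: "x j \<in> borel_measurable M" if "j \<le> n" for j using rv x that by blast
  have "expectation (\<lambda>\<omega>. f \<omega> * exp (l * (sgn (\<zeta> \<omega>) * x (min n (N \<omega>)) \<omega>)))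
      = expectation (\<lambda>\<omega>. \<Sum>i\<in>I. g i \<omega> * indicator (E i) \<omega>)"
  proof -
    have eq: "AE \<omega> in M. (\<Sum>i\<in>I. g i \<omega> * indicator (E i) \<omega>)
      = f \<omega> * exp (l * (sgn (\<zeta> \<omega>) * x (min n (N \<omega>)) \<omega>))"
      using AE_E
    proof eventually_elim
      case (elim \<omega>)
      then have \<omega>: "(N \<omega>, \<zeta> \<omega>) \<in> I" "\<omega> \<in> space M" by (auto simp: E_def)
      have "(\<Sum>i\<in>I. g i \<omega> * indicator (E i) \<omega>) = (\<Sum>i\<in>{(N \<omega>, \<zeta> \<omega>)}. g i \<omega> * indicator (E i) \<omega>)"
        using \<omega> I by (intro sum.mono_neutral_right) (auto simp: E_def indicator_def)
      also have "\<dots> = f \<omega> * exp (l * (sgn (\<zeta> \<omega>) * x (min n (N \<omega>)) \<omega>))"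
        using \<omega> by (auto simp: E_def g_def I_def)
      finally show ?case .
    qed
    have "(\<lambda>\<omega>. x (min n (N \<omega>)) \<omega>) \<in> borel_measurable M"
      by (rule measurable_compose_countable'[where I = "{..n}"]) (auto intro: x_meas)
    then show ?thesis using eq split(1) rv[OF f(1)]
      by (intro integral_cong_AE) (auto simp: eq_commute intro!: borel_measurable_sum)
  qed
  also have "\<dots> = (\<Sum>i\<in>I. W i * expectation (g i))"
    using split by (subst Bochner_Integration.integral_sum) auto
  also have "\<dots> = expectation (\<lambda>\<omega>. \<Sum>i\<in>I. W i * g i \<omega>)"
    using g_int by (subst Bochner_Integration.integral_sum) auto
  also have "\<dots> \<le> expectation (\<lambda>\<omega>. exp (l\<^sup>2 / 2) * (f \<omega> * exp (l * ((w 1 - w (-1)) * (\<Sum>j=1..n. x j \<omega>) / real n))))"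
  proof (rule integral_mono)
    show "integrable M (\<lambda>\<omega>. \<Sum>i\<in>I. W i * g i \<omega>)" using g_int by auto
    show "integrable M (\<lambda>\<omega>. exp (l\<^sup>2 / 2) * (f \<omega> * exp (l * ((w 1 - w (-1)) * (\<Sum>j=1..n. x j \<omega>) / real n))))"
    proof (intro integrable_mult_right integrable_times_exp[where B = "\<bar>w 1 - w (-1)\<bar>"])
      show "random_variable borel (\<lambda>\<omega>. (w 1 - w (-1)) * (\<Sum>j=1..n. x j \<omega>) / real n)"
        by (intro borel_measurable_divide borel_measurable_times borel_measurable_sum x_meas) auto
      fix \<omega>
      have "\<bar>\<Sum>j=1..n. x j \<omega>\<bar> \<le> (\<Sum>j=1..n. 1)"
        by (rule order_trans[OF sum_abs sum_mono]) (rule x_le)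
      then have "\<bar>w 1 - w (-1)\<bar> * \<bar>\<Sum>j=1..n. x j \<omega>\<bar> \<le> \<bar>w 1 - w (-1)\<bar> * real n"
        by (intro mult_left_mono) auto
      then show "\<bar>(w 1 - w (-1)) * (\<Sum>j=1..n. x j \<omega>) / real n\<bar> \<le> \<bar>w 1 - w (-1)\<bar>"
        using n by (simp add: abs_mult abs_divide pos_divide_le_eq del: right_diff_distrib left_diff_distrib)
    qed (rule f)
    fix \<omega>
    have mean: "(\<Sum>i\<in>I. W i * (snd i * x (fst i) \<omega>)) = (w 1 - w (-1)) * (\<Sum>j=1..n. x j \<omega>) / real n"
    proof -
      have "(\<Sum>i\<in>I. W i * (snd i * x (fst i) \<omega>)) = (\<Sum>j=1..n. (w 1 - w (-1)) / real n * x j \<omega>)"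
        unfolding sum_I W_def by (intro sum.cong refl) (simp add: diff_divide_distrib algebra_simps)
      then show ?thesis by (simp only: sum_distrib_left[symmetric]) simp
    qed
    have "(\<Sum>i\<in>I. W i * g i \<omega>) = f \<omega> * (\<Sum>i\<in>I. W i * exp (l * (snd i * x (fst i) \<omega>)))"
      by (simp add: g_def sum_distrib_left mult_ac)
    also have "\<dots> \<le> f \<omega> * exp (l * (\<Sum>i\<in>I. W i * (snd i * x (fst i) \<omega>)) + l\<^sup>2 / 2)"
      using f(3) x_le I W0 W1 by (intro mult_left_mono finite_hoeffding) (auto simp: I_def)
    finally show "(\<Sum>i\<in>I. W i * g i \<omega>) \<le> exp (l\<^sup>2 / 2) * (f \<omega> * exp (l * ((w 1 - w (-1)) * (\<Sum>j=1..n. x j \<omega>) / real n)))"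
      by (simp add: mean exp_add mult_ac)
  qed
  finally show ?thesis by simp
qed

end

section \<open>The walk as a function of its sources\<close>

context erw_stops_array
begin

abbreviation source :: "erw_source \<Rightarrow> 'a \<Rightarrow> int" where
  "source \<equiv> erw_family (X 1) U \<xi> V \<eta>"

text \<open>
  The sigma-algebra on \<open>space M\<close> generated by the sources in \<open>A\<close>. Working with measurability for it,
  rather than with explicit functions of the sources, turns independence of disjoint sets of sources
  into independence of everything that is built from them.
\<close>

definition history :: "erw_source set \<Rightarrow> 'a measure" where
  "history A = vimage_algebra (space M) (\<lambda>\<omega>. \<lambda>i\<in>A. source i \<omega>) (PiM A (\<lambda>_. count_space UNIV))"

lemma space_history [simp]: "space (history A) = space M"
  by (simp add: history_def)

lemma source_measurable_history: "i \<in> A \<Longrightarrow> source i \<in> history A \<rightarrow>\<^sub>M count_space UNIV"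
proof -
  assume i: "i \<in> A"
  have "(\<lambda>\<omega>. \<lambda>i\<in>A. source i \<omega>) \<in> history A \<rightarrow>\<^sub>M PiM A (\<lambda>_. count_space UNIV)"
    unfolding history_def by (rule measurable_vimage_algebra1) (auto simp: space_PiM)
  from measurable_compose[OF this measurable_component_singleton[OF i]] show ?thesis
    using i by simp
qed

lemma indep_history:
  assumes AB: "A \<inter> B = {}" "A \<subseteq> erw_sources m" "B \<subseteq> erw_sources m"
    and f: "f \<in> borel_measurable (history A)" and g: "g \<in> borel_measurable (history B)"
  shows "indep_var borel (f :: 'a \<Rightarrow> real) borel (g :: 'a \<Rightarrow> real)"
proof -
  have ind: "indep_set (sets (history A)) (sets (history B))"
    using indep_var_restrict[OF indep AB]
    unfolding indep_var_eq history_def sets_vimage_algebra by blast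
  then have sub: "sets (history A) \<subseteq> events" "sets (history B) \<subseteq> events"
    by (auto simp: indep_set_def indep_sets_def split: bool.splits)
  have gen: "sigma_sets (space M) {h -` S \<inter> space M |S. S \<in> sets borel} \<subseteq> sets (history C)"
    if "h \<in> borel_measurable (history C)" for h :: "'a \<Rightarrow> real" and C
  proof -
    have "{h -` S \<inter> space M |S. S \<in> sets borel} \<subseteq> sets (history C)"
      using measurable_sets[OF that] by auto
    from sets.sigma_sets_subset[OF this] show ?thesis by simp
  qed
  have rv: "random_variable borel h" if "h \<in> borel_measurable (history C)" "sets (history C) \<subseteq> events"
    for h :: "'a \<Rightarrow> real" and C
    using that by (auto simp: measurable_def)
  show ?thesis
    unfolding indep_var_eq
  proof (intro conjI rv[OF f sub(1)] rv[OF g sub(2)])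
    show "indep_set (sigma_sets (space M) {f -` S \<inter> space M |S. S \<in> sets borel})
       (sigma_sets (space M) {g -` S \<inter> space M |S. S \<in> sets borel})"
      using ind unfolding indep_set_def
      by (rule indep_sets_mono_sets) (use gen[OF f] gen[OF g] in \<open>auto split: bool.split\<close>)
  qed
qed

text \<open>
  The one-step bound for the two situations in which it is used, the walk and the rows of the array:
  \<open>P\<close> is the source of the index, \<open>C\<close> that of the choice, and neither belongs to the past \<open>A\<close>.
\<close>

lemma exp_moment_memory_step_history:
  fixes N :: "'a \<Rightarrow> nat" and \<zeta> :: "'a \<Rightarrow> int" and x :: "nat \<Rightarrow> 'a \<Rightarrow> real"
  assumes n: "1 \<le> n"
    and src: "insert P (insert C A) \<subseteq> erw_sources m" "P \<noteq> C" "P \<notin> A" "C \<notin> A"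
    and N: "source P = (\<lambda>\<omega>. int (N \<omega>))" "random_variable (count_space UNIV) N"
      "distr M (count_space UNIV) N = measure_pmf (pmf_of_set {1..n})"
    and \<zeta>: "source C = \<zeta>" "prob {\<omega> \<in> space M. \<zeta> \<omega> = 1} = p"
      "prob {\<omega> \<in> space M. \<zeta> \<omega> = - 1} = q" "prob {\<omega> \<in> space M. \<zeta> \<omega> = 0} = r"
    and f: "f \<in> borel_measurable (history A)" "integrable M f" "\<And>\<omega>. 0 \<le> f \<omega>"
    and x: "\<And>j. j \<le> n \<Longrightarrow> x j \<in> borel_measurable (history A)" "\<And>j \<omega>. \<bar>x j \<omega>\<bar> \<le> 1"
  shows "expectation (\<lambda>\<omega>. f \<omega> * exp (l * (sgn (\<zeta> \<omega>) * x (min n (N \<omega>)) \<omega>)))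
    \<le> exp (l\<^sup>2 / 2) * expectation (\<lambda>\<omega>. f \<omega> * exp (l * ((p - q) * (\<Sum>j=1..n. x j \<omega>) / real n)))"
proof -
  define w where "w z = (if z = 1 then p else if z = - 1 then q else r)" for z :: int
  have [measurable]: "random_variable (count_space UNIV) \<zeta>"
    using indep src(1) \<zeta>(1) by (auto simp: indep_vars_def)
  note [measurable] = N(2)
  have hist_N: "(\<lambda>\<omega>. h (N \<omega>)) \<in> borel_measurable (history B)" if "P \<in> B" for h :: "nat \<Rightarrow> real" and B
    using measurable_compose[OF source_measurable_history[OF that], of "\<lambda>i. h (nat i)" borel] N(1) by simp
  have hist_\<zeta>: "(\<lambda>\<omega>. h (\<zeta> \<omega>)) \<in> borel_measurable (history B)" if "C \<in> B" for h :: "int \<Rightarrow> real" and B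
    using measurable_compose[OF source_measurable_history[OF that], of h borel] \<zeta>(1) by simp
  have "expectation (\<lambda>\<omega>. f \<omega> * exp (l * (sgn (\<zeta> \<omega>) * x (min n (N \<omega>)) \<omega>)))
    \<le> exp (l\<^sup>2 / 2) * expectation (\<lambda>\<omega>. f \<omega> * exp (l * ((w 1 - w (- 1)) * (\<Sum>j=1..n. x j \<omega>) / real n)))"
  proof (rule exp_moment_memory_step[where G = "history A" and w = w])
    show "indep_var borel g borel (\<lambda>\<omega>. indicator {(j, z)} (N \<omega>, \<zeta> \<omega>) :: real)"
      if "g \<in> borel_measurable (history A)" for g :: "'a \<Rightarrow> real" and j z
    proof (rule indep_history[where A = A and B = "{P, C}"])
      have "(\<lambda>\<omega>. indicator {j} (N \<omega>) * indicator {z} (\<zeta> \<omega>) :: real) \<in> borel_measurable (history {P, C})"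
        by (intro borel_measurable_times hist_N hist_\<zeta>) auto
      also have "(\<lambda>\<omega>. indicator {j} (N \<omega>) * indicator {z} (\<zeta> \<omega>) :: real) = (\<lambda>\<omega>. indicator {(j, z)} (N \<omega>, \<zeta> \<omega>))"
        by (auto simp: indicator_def)
      finally show "(\<lambda>\<omega>. indicator {(j, z)} (N \<omega>, \<zeta> \<omega>) :: real) \<in> borel_measurable (history {P, C})" .
    qed (use src that in auto)
    show "prob {\<omega> \<in> space M. N \<omega> = j \<and> \<zeta> \<omega> = z} = w z / real n"
      if j: "j \<in> {1..n}" and z: "z \<in> {- 1, 0, 1}" for j z
    proof -
      have "prob (N -` {j} \<inter> space M) = measure (distr M (count_space UNIV) N) {j}"
        by (subst measure_distr) auto
      also have "\<dots> = 1 / real n"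
        using j n by (simp add: N(3) measure_pmf_single)
      finally have pN: "prob (N -` {j} \<inter> space M) = 1 / real n" .
      have p\<zeta>: "prob (\<zeta> -` {z} \<inter> space M) = w z"
        using z \<zeta> by (auto simp: w_def vimage_def Int_def conj_commute)
      have "indep_var borel (\<lambda>\<omega>. real (N \<omega>)) borel (\<lambda>\<omega>. real_of_int (\<zeta> \<omega>))"
        by (rule indep_history[where A = "{P}" and B = "{C}"]) (use src in \<open>auto intro: hist_N hist_\<zeta>\<close>)
      from indep_varD[OF this, of "{real j}" "{real_of_int z}"]
      have "prob ((\<lambda>\<omega>. (real (N \<omega>), real_of_int (\<zeta> \<omega>))) -` ({real j} \<times> {real_of_int z}) \<inter> space M)
        = prob ((\<lambda>\<omega>. real (N \<omega>)) -` {real j} \<inter> space M) * prob ((\<lambda>\<omega>. real_of_int (\<zeta> \<omega>)) -` {real_of_int z} \<inter> space M)"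
        by simp
      also have "(\<lambda>\<omega>. real (N \<omega>)) -` {real j} \<inter> space M = N -` {j} \<inter> space M" by auto
      also have "(\<lambda>\<omega>. real_of_int (\<zeta> \<omega>)) -` {real_of_int z} \<inter> space M = \<zeta> -` {z} \<inter> space M" by auto
      also have "(\<lambda>\<omega>. (real (N \<omega>), real_of_int (\<zeta> \<omega>))) -` ({real j} \<times> {real_of_int z}) \<inter> space M
          = {\<omega> \<in> space M. N \<omega> = j \<and> \<zeta> \<omega> = z}" by auto
      finally show ?thesis using pN p\<zeta> by simp
    qed
    show "\<And>z. z \<in> {- 1, 0, 1} \<Longrightarrow> 0 \<le> w z" using p q r by (auto simp: w_def)
    show "w (- 1) + w 0 + w 1 = 1" using pqr by (simp add: w_def)
  qed (use n f x in \<open>auto simp: N\<close>)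
  then show ?thesis by (simp add: w_def)
qed

text \<open>
  A version of the walk that is built from the sources at every \<open>\<omega>\<close>. It agrees with \<open>X\<close> almost surely,
  but is bounded by \<open>1\<close> everywhere and measurable for the sigma-algebra of its sources, which holds
  for \<open>X\<close> only up to null sets.
\<close>

fun step :: "nat \<Rightarrow> 'a \<Rightarrow> int" where
  "step 0 \<omega> = 0"
| "step (Suc k) \<omega> = (if k = 0 then sgn (X 1 \<omega>) else sgn (\<xi> k \<omega>) * step (min k (U k \<omega>)) \<omega>)"

definition row_step :: "nat \<Rightarrow> nat \<Rightarrow> 'a \<Rightarrow> int" where
  "row_step n k \<omega> = sgn (\<eta> n k \<omega>) * step (min (m n) (V n k \<omega>)) \<omega>"

definition walk :: "nat \<Rightarrow> 'a \<Rightarrow> real" where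
  "walk n \<omega> = (\<Sum>k=1..n. real_of_int (step k \<omega>))"

text \<open>
  The sum of the first \<open>i\<close> row steps, centred at its conditional mean given the walk up to time
  \<open>m n\<close>.
\<close>

definition row_dev :: "nat \<Rightarrow> nat \<Rightarrow> 'a \<Rightarrow> real" where
  "row_dev n i \<omega> =
     (\<Sum>k\<in>{m n<..m n + i}. real_of_int (row_step n k \<omega>)) - real i * ((p - q) * walk (m n) \<omega> / real (m n))"

definition walk_sources :: "nat \<Rightarrow> erw_source set" where
  "walk_sources n = {Init} \<union> Pick ` {1..<n} \<union> Choice ` {1..<n}"

definition row_sources :: "nat \<Rightarrow> nat \<Rightarrow> erw_source set" where
  "row_sources n i = Row_Pick n ` {m n<..m n + i} \<union> Row_Choice n ` {m n<..m n + i}"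

lemma abs_sgn_le_1: "\<bar>sgn (z :: int)\<bar> \<le> 1"
  by (simp add: abs_sgn_eq)

lemma abs_step_le_1: "\<bar>step k \<omega>\<bar> \<le> 1"
proof (induction k \<omega> rule: step.induct)
  case (2 k \<omega>)
  then show ?case
    using mult_le_one[OF abs_sgn_le_1, of "\<bar>step (min k (U k \<omega>)) \<omega>\<bar>"] by (auto simp: abs_sgn_le_1 abs_mult)
qed simp

lemma abs_row_step_le_1: "\<bar>row_step n k \<omega>\<bar> \<le> 1"
  using mult_le_one[OF abs_sgn_le_1 abs_ge_zero abs_step_le_1] by (simp add: row_step_def abs_mult)

lemma abs_walk_le: "\<bar>walk n \<omega>\<bar> \<le> real n"
proof -
  have "\<bar>walk n \<omega>\<bar> \<le> (\<Sum>k=1..n. 1)"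
    unfolding walk_def using abs_step_le_1
    by (intro order_trans[OF sum_abs sum_mono]) (metis of_int_abs of_int_le_1_iff)
  then show ?thesis by simp
qed

lemma remembered_step_measurable_history:
  assumes P: "P \<in> A" "source P = (\<lambda>\<omega>. int (N \<omega>))" and C: "C \<in> A" "source C = \<zeta>"
    and step: "\<And>k. k \<le> n \<Longrightarrow> (\<lambda>\<omega>. real_of_int (step k \<omega>)) \<in> borel_measurable (history A)"
  shows "(\<lambda>\<omega>. real_of_int (sgn (\<zeta> \<omega>) * step (min n (N \<omega>)) \<omega>)) \<in> borel_measurable (history A)"
  unfolding of_int_mult
proof (rule borel_measurable_times)
  show "(\<lambda>\<omega>. real_of_int (sgn (\<zeta> \<omega>))) \<in> borel_measurable (history A)"
    using measurable_compose[OF source_measurable_history[OF C(1)], of "\<lambda>z. real_of_int (sgn z)" borel] C(2)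
    by simp
  show "(\<lambda>\<omega>. real_of_int (step (min n (N \<omega>)) \<omega>)) \<in> borel_measurable (history A)"
  proof (rule measurable_compose_countable'[where I = "{..n}"])
    have "(\<lambda>\<omega>. min n (nat (source P \<omega>))) \<in> history A \<rightarrow>\<^sub>M count_space {..n}"
      by (rule measurable_compose[OF source_measurable_history[OF P(1)]]) simp
    then show "(\<lambda>\<omega>. min n (N \<omega>)) \<in> history A \<rightarrow>\<^sub>M count_space {..n}"
      unfolding P(2) nat_int .
  qed (use step in auto)
qed

lemma step_measurable_history:
  assumes "walk_sources n \<subseteq> A" "k \<le> n"
  shows "(\<lambda>\<omega>. real_of_int (step k \<omega>)) \<in> borel_measurable (history A)"
  using assms(2)
proof (induction k rule: less_induct)
  case (less k)
  consider "k = 0" | "k = 1" | j where "k = Suc j" "1 \<le> j" by (cases k) force+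
  then show ?case
  proof cases
    case 1
    then show ?thesis by simp
  next
    case 2
    have "Init \<in> A" using assms(1) by (auto simp: walk_sources_def)
    from measurable_compose[OF source_measurable_history[OF this], of "\<lambda>z. real_of_int (sgn z)" borel]
    show ?thesis using 2 by simp
  next
    case (3 j)
    then have PC: "Pick j \<in> A" "Choice j \<in> A" using assms(1) less.prems by (auto simp: walk_sources_def)
    have "(\<lambda>\<omega>. real_of_int (sgn (\<xi> j \<omega>) * step (min j (U j \<omega>)) \<omega>)) \<in> borel_measurable (history A)"
      by (rule remembered_step_measurable_history[OF PC(1) _ PC(2)]) (use less 3 in auto)
    then show ?thesis using 3 by simp
  qed
qed

lemma row_step_measurable_history:
  assumes "walk_sources (m n) \<subseteq> A" "row_sources n i \<subseteq> A" "k \<in> {m n<..m n + i}"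
  shows "(\<lambda>\<omega>. real_of_int (row_step n k \<omega>)) \<in> borel_measurable (history A)"
proof -
  have PC: "Row_Pick n k \<in> A" "Row_Choice n k \<in> A" using assms by (auto simp: row_sources_def)
  show ?thesis
    unfolding row_step_def
    by (rule remembered_step_measurable_history[OF PC(1) _ PC(2)])
       (use step_measurable_history[OF assms(1)] in auto)
qed

lemma walk_measurable_history:
  assumes "walk_sources n \<subseteq> A"
  shows "walk n \<in> borel_measurable (history A)"
  unfolding walk_def[abs_def]
  by (intro borel_measurable_sum step_measurable_history[OF assms]) auto

lemma row_dev_measurable_history:
  assumes "walk_sources (m n) \<subseteq> A" "row_sources n i \<subseteq> A"
  shows "row_dev n i \<in> borel_measurable (history A)"
  unfolding row_dev_def[abs_def]
  by (intro borel_measurable_diff borel_measurable_times borel_measurable_divide borel_measurable_const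
      borel_measurable_sum row_step_measurable_history[OF assms]
      walk_measurable_history[OF assms(1)]) auto

lemma random_variable_history:
  assumes "A \<subseteq> erw_sources m" "f \<in> borel_measurable (history A)"
  shows "random_variable borel (f :: 'a \<Rightarrow> real)"
  using indep_var_rv1[OF indep_history[of A "{}" f "\<lambda>_. 0"]] assms by simp

lemma walk_sources_subset: "walk_sources n \<subseteq> erw_sources m"
  by (auto simp: walk_sources_def erw_sources_def)

lemma row_sources_subset: "1 \<le> n \<Longrightarrow> m n + i \<le> n \<Longrightarrow> row_sources n i \<subseteq> erw_sources m"
  by (auto simp: row_sources_def erw_sources_def)

section \<open>Exponential moments of the walk and of the rows\<close>

lemma walk_random_variable [measurable]: "random_variable borel (walk n)"
  by (rule random_variable_history[OF walk_sources_subset walk_measurable_history[OF order_refl]])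

text \<open>
  Each step turns the exponential moment at \<open>l\<close> into the one at \<open>l * (1 + (p - q) / n)\<close>, because the
  conditional mean of the new step is \<open>(p - q) / n\<close> times the current position; this is the recursion
  of \<open>walk_var\<close>. The constant \<open>exp (1 / 2)\<close> comes from the first step alone, through
  \<open>\<bar>l\<bar> \<le> 1 / 2 + l\<^sup>2 / 2\<close>.
\<close>

lemma walk_subgaussian:
  assumes "1 \<le> n"
  shows "subgaussian (exp (1 / 2)) (walk_var (p - q) n) (walk n)"
  unfolding subgaussian_def
proof (intro conjI allI walk_random_variable)
  show int: "integrable M (\<lambda>\<omega>. exp (l * walk n \<omega>))" for n l
    by (rule integrable_exp_bounded[OF walk_random_variable abs_walk_le])
  show "expectation (\<lambda>\<omega>. exp (l * walk n \<omega>)) \<le> exp (1 / 2) * exp (l\<^sup>2 * walk_var (p - q) n / 2)" for l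
    using assms
  proof (induction n arbitrary: l rule: nat_induct_at_least)
    case base
    have "exp (l * walk 1 \<omega>) \<le> exp (1 / 2) * exp (l\<^sup>2 / 2)" for \<omega>
    proof -
      have "l * walk 1 \<omega> \<le> \<bar>l\<bar> * \<bar>walk 1 \<omega>\<bar>" by (metis abs_ge_self abs_mult)
      also have "\<dots> \<le> \<bar>l\<bar> * 1" using abs_walk_le[of 1 \<omega>] by (intro mult_left_mono) auto
      also have "\<dots> \<le> 1 / 2 + l\<^sup>2 / 2"
        using zero_le_power2[of "\<bar>l\<bar> - 1"] by (simp add: power2_diff)
      finally show ?thesis by (simp flip: exp_add)
    qed
    then have "expectation (\<lambda>\<omega>. exp (l * walk 1 \<omega>)) \<le> exp (1 / 2) * exp (l\<^sup>2 / 2)"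
      by (intro integral_le_const int AE_I2)
    then show ?case by simp
  next
    case (Suc n)
    let ?a = "p - q"
    define b where "b = 1 + ?a / real n"
    have rec: "walk (Suc n) \<omega> = walk n \<omega> + sgn (\<xi> n \<omega>) * step (min n (U n \<omega>)) \<omega>" for \<omega>
      using Suc.hyps by (simp add: walk_def)
    have "expectation (\<lambda>\<omega>. exp (l * walk (Suc n) \<omega>))
        = expectation (\<lambda>\<omega>. exp (l * walk n \<omega>) * exp (l * (sgn (\<xi> n \<omega>) * real_of_int (step (min n (U n \<omega>)) \<omega>))))"
      by (simp add: rec distrib_left exp_add)
    also have "\<dots> \<le> exp (l\<^sup>2 / 2) * expectation (\<lambda>\<omega>. exp (l * walk n \<omega>) *
        exp (l * (?a * (\<Sum>j=1..n. real_of_int (step j \<omega>)) / real n)))"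
    proof (rule exp_moment_memory_step_history[where A = "walk_sources n" and P = "Pick n" and C = "Choice n"])
      show "(\<lambda>\<omega>. exp (l * walk n \<omega>)) \<in> borel_measurable (history (walk_sources n))"
        by (intro borel_measurable_exp[THEN measurable_compose[rotated]] borel_measurable_times
            borel_measurable_const walk_measurable_history order_refl)
      show "(\<lambda>\<omega>. real_of_int (step j \<omega>)) \<in> borel_measurable (history (walk_sources n))" if "j \<le> n" for j
        by (rule step_measurable_history[OF order_refl that])
      show "\<bar>real_of_int (step j \<omega>)\<bar> \<le> 1" for j \<omega>
        using abs_step_le_1[of j \<omega>] by linarith
    qed (use Suc.hyps int measurable_U law_U law_\<xi> in \<open>auto simp: walk_sources_def erw_sources_def\<close>)
    also have "\<dots> = exp (l\<^sup>2 / 2) * expectation (\<lambda>\<omega>. exp ((l * b) * walk n \<omega>))"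
      unfolding walk_def[symmetric] b_def
      by (simp add: algebra_simps add_divide_distrib diff_divide_distrib flip: exp_add)
    also have "\<dots> \<le> exp (l\<^sup>2 / 2) * (exp (1 / 2) * exp ((l * b)\<^sup>2 * walk_var ?a n / 2))"
      by (intro mult_left_mono Suc.IH) auto
    also have "\<dots> = exp (1 / 2) * exp (l\<^sup>2 * walk_var ?a (Suc n) / 2)"
      by (simp add: b_def[symmetric] power_mult_distrib distrib_left add_divide_distrib mult.assoc flip: exp_add)
    finally show ?case .
  qed
qed

text \<open>
  The row steps all look back at the same \<open>m n\<close> steps, so their conditional mean never changes and each
  of them adds exactly one unit to the variance proxy. No initial bias occurs, hence \<open>C = 1\<close>.
\<close>

lemma row_dev_subgaussian:
  assumes n: "1 \<le> n" and "m n + i \<le> n"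
  shows "subgaussian 1 (real i) (row_dev n i)"
proof -
  let ?a = "p - q"
  define A where "A i = walk_sources (m n) \<union> row_sources n i" for i
  have mn: "1 \<le> m n" using m[OF n] by simp
  have A: "walk_sources (m n) \<subseteq> A i" "row_sources n i \<subseteq> A i" for i by (auto simp: A_def)
  have A_sub: "A i \<subseteq> erw_sources m" if "m n + i \<le> n" for i
    using walk_sources_subset row_sources_subset[OF n that] by (auto simp: A_def)
  have rv: "random_variable borel (row_dev n i)" if "m n + i \<le> n" for i
    by (rule random_variable_history[OF A_sub[OF that] row_dev_measurable_history[OF A]])
  have drift: "\<bar>?a * walk (m n) \<omega> / real (m n)\<bar> \<le> \<bar>?a\<bar>" for \<omega>
    using mult_left_mono[OF abs_walk_le[of "m n" \<omega>], of "\<bar>?a\<bar>"] mn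
    by (simp add: abs_mult abs_divide pos_divide_le_eq)
  have bound: "\<bar>row_dev n i \<omega>\<bar> \<le> real i + real i * \<bar>?a\<bar>" for i \<omega>
  proof -
    have "\<bar>\<Sum>k\<in>{m n<..m n + i}. real_of_int (row_step n k \<omega>)\<bar> \<le> (\<Sum>k\<in>{m n<..m n + i}. 1)"
    proof (rule order_trans[OF sum_abs sum_mono])
      show "\<bar>real_of_int (row_step n k \<omega>)\<bar> \<le> 1" for k using abs_row_step_le_1[of n k \<omega>] by linarith
    qed
    moreover have "\<bar>real i * (?a * walk (m n) \<omega> / real (m n))\<bar> \<le> real i * \<bar>?a\<bar>"
      unfolding abs_mult[of "real i"] using drift by (intro mult_mono) auto
    ultimately show ?thesis unfolding row_dev_def by (simp del: times_divide_eq_right)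
  qed
  have int: "integrable M (\<lambda>\<omega>. exp (l * row_dev n i \<omega>))" if "m n + i \<le> n" for i l
    by (rule integrable_exp_bounded[OF rv[OF that] bound])
  have "expectation (\<lambda>\<omega>. exp (l * row_dev n i \<omega>)) \<le> exp (l\<^sup>2 * real i / 2)" for l
    using assms(2)
  proof (induction i)
    case 0
    then show ?case by (simp add: row_dev_def prob_space)
  next
    case (Suc i)
    let ?k = "m n + Suc i"
    define c where "c \<omega> = ?a * walk (m n) \<omega> / real (m n)" for \<omega>
    have rec: "row_dev n (Suc i) \<omega> = row_dev n i \<omega> - c \<omega>
        + sgn (\<eta> n ?k \<omega>) * step (min (m n) (V n ?k \<omega>)) \<omega>" for \<omega>
    proof -
      have "{m n<..m n + Suc i} = insert ?k {m n<..m n + i}" by auto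
      then show ?thesis by (simp add: row_dev_def row_step_def c_def algebra_simps add_divide_distrib diff_divide_distrib)
    qed
    have c_meas: "c \<in> borel_measurable (history (A i))"
      unfolding c_def[abs_def]
      by (intro borel_measurable_times borel_measurable_divide borel_measurable_const walk_measurable_history A)
    have "expectation (\<lambda>\<omega>. exp (l * row_dev n (Suc i) \<omega>))
        = expectation (\<lambda>\<omega>. exp (l * (row_dev n i \<omega> - c \<omega>)) *
            exp (l * (sgn (\<eta> n ?k \<omega>) * real_of_int (step (min (m n) (V n ?k \<omega>)) \<omega>))))"
      by (simp only: rec distrib_left exp_add of_int_mult)
    also have "\<dots> \<le> exp (l\<^sup>2 / 2) * expectation (\<lambda>\<omega>. exp (l * (row_dev n i \<omega> - c \<omega>)) *
        exp (l * (?a * (\<Sum>j=1..m n. real_of_int (step j \<omega>)) / real (m n))))"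
    proof (rule exp_moment_memory_step_history[where A = "A i" and P = "Row_Pick n ?k" and C = "Row_Choice n ?k"])
      show "(\<lambda>\<omega>. exp (l * (row_dev n i \<omega> - c \<omega>))) \<in> borel_measurable (history (A i))"
        by (intro borel_measurable_exp[THEN measurable_compose[rotated]] borel_measurable_times
            borel_measurable_diff borel_measurable_const row_dev_measurable_history A c_meas)
      show "(\<lambda>\<omega>. real_of_int (step j \<omega>)) \<in> borel_measurable (history (A i))" if "j \<le> m n" for j
        by (rule step_measurable_history[OF A(1) that])
      show "\<bar>real_of_int (step j \<omega>)\<bar> \<le> 1" for j \<omega>
        using abs_step_le_1[of j \<omega>] by linarith
      show "integrable M (\<lambda>\<omega>. exp (l * (row_dev n i \<omega> - c \<omega>)))"
      proof (rule integrable_exp_bounded)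
        show "random_variable borel (\<lambda>\<omega>. row_dev n i \<omega> - c \<omega>)"
          using Suc.prems by (intro borel_measurable_diff rv random_variable_history[OF A_sub c_meas]) auto
        show "\<bar>row_dev n i \<omega> - c \<omega>\<bar> \<le> (real i + real i * \<bar>?a\<bar>) + \<bar>?a\<bar>" for \<omega>
          unfolding c_def by (rule order_trans[OF abs_triangle_ineq4 add_mono[OF bound drift]])
      qed
      show "insert (Row_Pick n ?k) (insert (Row_Choice n ?k) (A i)) \<subseteq> erw_sources m"
        using A_sub[of i] Suc.prems n by (auto simp: erw_sources_def)
    qed (use Suc.prems mn n measurable_V law_V law_\<eta> in \<open>auto simp: A_def walk_sources_def row_sources_def\<close>)
    also have "\<dots> = exp (l\<^sup>2 / 2) * expectation (\<lambda>\<omega>. exp (l * row_dev n i \<omega>))"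
      unfolding walk_def[symmetric] c_def[symmetric]
      by (simp add: algebra_simps flip: exp_add)
    also have "\<dots> \<le> exp (l\<^sup>2 / 2) * exp (l\<^sup>2 * real i / 2)"
      using Suc by (intro mult_left_mono) auto
    also have "\<dots> = exp (l\<^sup>2 * real (Suc i) / 2)"
      by (simp add: algebra_simps add_divide_distrib flip: exp_add)
    finally show ?case .
  qed
  then show ?thesis using rv[OF assms(2)] int[OF assms(2)] unfolding subgaussian_def by simp
qed


section \<open>Almost sure convergence\<close>

text \<open>
  The inequality in the hypothesis lets the lemma cover the first step too, where the mass at \<open>0\<close> is
  known only to be nonnegative.
\<close>

lemma sgn_choice_AE:
  assumes [measurable]: "random_variable (count_space UNIV) (\<zeta> :: 'a \<Rightarrow> int)"
    and "1 \<le> prob {\<omega> \<in> space M. \<zeta> \<omega> = 1} + prob {\<omega> \<in> space M. \<zeta> \<omega> = - 1}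
      + prob {\<omega> \<in> space M. \<zeta> \<omega> = 0}"
  shows "AE \<omega> in M. sgn (\<zeta> \<omega>) = \<zeta> \<omega>"
proof -
  have "prob (\<Union>z\<in>{1, - 1, 0}. {\<omega> \<in> space M. \<zeta> \<omega> = z}) = (\<Sum>z\<in>{1, - 1, 0}. prob {\<omega> \<in> space M. \<zeta> \<omega> = z})"
    by (intro finite_measure_finite_Union) (auto simp: disjoint_family_on_def)
  also have "\<dots> \<ge> 1" using assms(2) by simp
  finally have "prob (\<Union>z\<in>{1, - 1, 0}. {\<omega> \<in> space M. \<zeta> \<omega> = z}) = 1" by (intro antisym) auto
  then have "AE \<omega> in M. \<omega> \<in> (\<Union>z\<in>{1, - 1, 0}. {\<omega> \<in> space M. \<zeta> \<omega> = z})" by (rule AE_prob_1)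
  then show ?thesis by eventually_elim auto
qed

lemma uniform_index_AE:
  assumes [measurable]: "random_variable (count_space UNIV) (N :: 'a \<Rightarrow> nat)" and "1 \<le> n"
    and law: "distr M (count_space UNIV) N = measure_pmf (pmf_of_set {1..n})"
  shows "AE \<omega> in M. N \<omega> \<in> {1..n}"
proof -
  have "set_pmf (pmf_of_set {1..n}) = {1..n}" using assms(2) by (intro set_pmf_of_set) auto
  then have "AE j in distr M (count_space UNIV) N. j \<in> {1..n}"
    unfolding law AE_measure_pmf_iff by blast
  then show ?thesis by (subst (asm) AE_distr_iff) auto
qed

lemma random_variable_source:
  "i \<in> erw_sources m \<Longrightarrow> random_variable (count_space UNIV) (source i)"
  using indep by (auto simp: indep_vars_def)

lemma X_eq_step_AE: "AE \<omega> in M. \<forall>k\<ge>1. X k \<omega> = step k \<omega>"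
proof -
  have X1: "AE \<omega> in M. sgn (X 1 \<omega>) = X 1 \<omega>"
    using law_X1 measurable_X[of 1] by (intro sgn_choice_AE) auto
  have step: "AE \<omega> in M. 1 \<le> n \<longrightarrow> X (n + 1) \<omega> = \<xi> n \<omega> * X (U n \<omega>) \<omega> \<and> U n \<omega> \<in> {1..n} \<and> sgn (\<xi> n \<omega>) = \<xi> n \<omega>" for n
  proof (cases "1 \<le> n")
    case True
    have \<xi>: "random_variable (count_space UNIV) (\<xi> n)"
      using random_variable_source[of "Choice n"] True by (auto simp: erw_sources_def)
    have \<xi>_sgn: "AE \<omega> in M. sgn (\<xi> n \<omega>) = \<xi> n \<omega>"
      using \<xi> law_\<xi>[OF True] pqr by (intro sgn_choice_AE) auto
    show ?thesis
      using step_X[OF True] uniform_index_AE[OF measurable_U[OF True] True law_U[OF True]] \<xi>_sgn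
      by eventually_elim auto
  qed simp
  then have "AE \<omega> in M. \<forall>n. 1 \<le> n \<longrightarrow> X (n + 1) \<omega> = \<xi> n \<omega> * X (U n \<omega>) \<omega> \<and> U n \<omega> \<in> {1..n} \<and> sgn (\<xi> n \<omega>) = \<xi> n \<omega>"
    by (subst AE_all_countable) auto
  with X1 show ?thesis
  proof eventually_elim
    case (elim \<omega>)
    show ?case
    proof (intro allI impI)
      fix k :: nat assume "1 \<le> k"
      then show "X k \<omega> = step k \<omega>"
      proof (induction k rule: less_induct)
        case (less k)
        show ?case
        proof (cases "k = 1")
          case True
          then show ?thesis using elim(1) by simp
        next
          case False
          then obtain n where n: "k = Suc n" "1 \<le> n" using less.prems by (cases k) auto
          note E = elim(2)[rule_format, OF n(2)]
          have "X (U n \<omega>) \<omega> = step (U n \<omega>) \<omega>"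
            using E n by (intro less.IH) auto
          then show ?thesis using E n by simp
        qed
      qed
    qed
  qed
qed

lemma X'_eq_row_step_AE:
  "AE \<omega> in M. \<forall>n k. 1 \<le> n \<longrightarrow> m n < k \<longrightarrow> k \<le> n \<longrightarrow> X' n k \<omega> = row_step n k \<omega>"
proof -
  have "AE \<omega> in M. 1 \<le> n \<longrightarrow> m n < k \<longrightarrow> k \<le> n \<longrightarrow> X' n k \<omega> = row_step n k \<omega>" for n k
  proof (cases "1 \<le> n \<and> m n < k \<and> k \<le> n")
    case True
    then have nk: "1 \<le> n" "m n < k" "k \<le> n" by auto
    have \<eta>: "random_variable (count_space UNIV) (\<eta> n k)"
      using random_variable_source[of "Row_Choice n k"] nk by (auto simp: erw_sources_def)
    have \<eta>_sgn: "AE \<omega> in M. sgn (\<eta> n k \<omega>) = \<eta> n k \<omega>"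
      using \<eta> law_\<eta>[OF nk] pqr by (intro sgn_choice_AE) auto
    have "1 \<le> m n" using m nk by blast
    from step_X'[OF nk] uniform_index_AE[OF measurable_V[OF nk] this law_V[OF nk]]
      \<eta>_sgn X_eq_step_AE
    show ?thesis by eventually_elim (auto simp: row_step_def)
  qed auto
  then show ?thesis by (simp add: AE_all_countable)
qed

text \<open>
  The basic decomposition: the walk up to time \<open>m n\<close>, plus the conditional mean of the row steps, which
  is a multiple of it, plus the fluctuation of the row.
\<close>

lemma array_walk_AE:
  "AE \<omega> in M. \<forall>n\<ge>1. real_of_int (array_walk m X X' n \<omega>)
     = (1 + real (n - m n) * (p - q) / real (m n)) * walk (m n) \<omega> + row_dev n (n - m n) \<omega>"
  using X_eq_step_AE X'_eq_row_step_AE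
proof eventually_elim
  case (elim \<omega>)
  show ?case
  proof (intro allI impI)
    fix n :: nat assume n: "1 \<le> n"
    have mn: "m n \<le> n" using m[OF n] by simp
    have "array_walk m X X' n \<omega> = (\<Sum>k\<in>{1..m n} \<union> {m n<..n}. array_step m X X' n k \<omega>)"
      unfolding array_walk_def using mn by (intro sum.cong) auto
    also have "\<dots> = (\<Sum>k\<in>{1..m n}. array_step m X X' n k \<omega>) + (\<Sum>k\<in>{m n<..n}. array_step m X X' n k \<omega>)"
      by (rule sum.union_disjoint) auto
    also have "(\<Sum>k\<in>{1..m n}. array_step m X X' n k \<omega>) = (\<Sum>k\<in>{1..m n}. step k \<omega>)"
      using elim(1) by (intro sum.cong refl) (auto simp: array_step_def)
    also have "(\<Sum>k\<in>{m n<..n}. array_step m X X' n k \<omega>) = (\<Sum>k\<in>{m n<..n}. row_step n k \<omega>)"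
      using elim(2) n by (intro sum.cong refl) (auto simp: array_step_def)
    finally show "real_of_int (array_walk m X X' n \<omega>)
      = (1 + real (n - m n) * (p - q) / real (m n)) * walk (m n) \<omega> + row_dev n (n - m n) \<omega>"
      using mn by (simp add: row_dev_def walk_def algebra_simps)
  qed
qed

lemma walk_div_powr_tendsto_0:
  assumes "p - q < c" "1 / 2 < c"
  shows "AE \<omega> in M. (\<lambda>n. walk n \<omega> / real n powr c) \<longlonglongrightarrow> 0"
proof -
  \<comment> \<open>the variance proxy is at most of order \<open>n powr (2 d)\<close>; the gap between \<open>d\<close> and \<open>c\<close> provides the exponent \<open>\<kappa>\<close>\<close>
  obtain d where d: "max (p - q) (1 / 2) < d" "d < c"
    using dense[of "max (p - q) (1 / 2)" c] assms by auto
  obtain K where K: "0 < K" "\<And>n. 1 \<le> n \<Longrightarrow> walk_var (p - q) n \<le> K * real n powr (2 * d)"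
    using walk_var_le_powr[of "p - q" d] d by auto
  show ?thesis
  proof (rule subgaussian_AE_tendsto_0[OF walk_subgaussian walk_var_pos _ _ K(1)])
    show "0 < 2 * (c - d)" using d by simp
    fix n :: nat assume n: "1 \<le> n"
    have "real n powr (2 * (c - d)) * walk_var (p - q) n \<le> real n powr (2 * (c - d)) * (K * real n powr (2 * d))"
      by (intro mult_left_mono K n) auto
    also have "\<dots> = K * (real n powr c)\<^sup>2"
      using n by (simp add: power2_eq_square algebra_simps flip: powr_add)
    finally show "real n powr (2 * (c - d)) * walk_var (p - q) n \<le> K * (real n powr c)\<^sup>2" .
  qed auto
qed

text \<open>
  The tail bounds have to decay in \<open>n\<close>, since bounds that decay only in \<open>m n\<close> need not be summable
  when \<open>m\<close> grows slowly. They do: as \<open>c < 1\<close> and \<open>m n \<le> n\<close>, the normalisation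
  is at least \<open>n powr c\<close>, against a variance proxy \<open>n\<close>.
\<close>

lemma row_dev_tendsto_0:
  assumes c: "1 / 2 < c" "c < 1"
  shows "AE \<omega> in M. (\<lambda>n. row_dev n (n - m n) \<omega> / (real n * real (m n) powr (c - 1))) \<longlonglongrightarrow> 0"
proof (rule subgaussian_AE_tendsto_0[where C = 1 and v = real and
      Z = "\<lambda>n. row_dev n (n - m n)" and b = "\<lambda>n. real n * real (m n) powr (c - 1)" and \<kappa> = "2 * c - 1" and K = 1])
  fix n :: nat assume n: "1 \<le> n"
  note mn = m[OF n]
  have "subgaussian 1 (real (n - m n)) (row_dev n (n - m n))"
    using mn by (intro row_dev_subgaussian n) auto
  moreover have "exp (l\<^sup>2 * real (n - m n) / 2) \<le> exp (l\<^sup>2 * real n / 2)" for l :: real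
    by (simp add: mult_left_mono)
  ultimately show "subgaussian 1 (real n) (row_dev n (n - m n))"
    unfolding subgaussian_def by (auto intro: order_trans)
  show "0 < real n" "0 < real n * real (m n) powr (c - 1)" using n mn by auto
  have "real n powr (2 * c - 1) * real n = (real n * real n powr (c - 1))\<^sup>2"
  proof -
    have "real n * real n powr (c - 1) = real n powr c" "real n powr (2 * c - 1) * real n = real n powr (2 * c)"
      using n by (simp_all add: powr_diff)
    then show ?thesis by (simp add: power2_eq_square flip: powr_add)
  qed
  also have "\<dots> \<le> (real n * real (m n) powr (c - 1))\<^sup>2"
    using c mn by (intro power_mono mult_left_mono powr_mono2') auto
  finally show "real n powr (2 * c - 1) * real n \<le> 1 * (real n * real (m n) powr (c - 1))\<^sup>2" by simp
qed (use c in auto)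

text \<open>
  With \<open>\<gamma> = m n / n\<close> and \<open>a = p - q\<close>, scaling turns the coefficient of the walk in the decomposition into
  \<open>\<gamma> + a (1 - \<gamma>)\<close>, which lies in \<open>[-1, 1]\<close>. So the first part is dominated by the
  normalised walk at time \<open>m n\<close>, which is small along with the whole sequence because \<open>m n\<close> tends
  to infinity.
\<close>

lemma scaled_array_walk_tendsto_0:
  assumes m_lim: "filterlim m at_top sequentially" and c: "p - q < c" "1 / 2 < c" "c < 1"
  shows "AE \<omega> in M. (\<lambda>n. real (m n) / real n * real_of_int (array_walk m X X' n \<omega>) / real (m n) powr c) \<longlonglongrightarrow> 0"
  using array_walk_AE walk_div_powr_tendsto_0[OF c(1,2)] row_dev_tendsto_0[OF c(2,3)]
proof eventually_elim
  case (elim \<omega>)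
  note T = elim(1)
  define \<gamma> where "\<gamma> n = real (m n) / real n" for n
  define a where "a = p - q"
  have W: "(\<lambda>n. walk (m n) \<omega> / real (m n) powr c) \<longlonglongrightarrow> 0"
    using filterlim_compose[OF elim(2) m_lim] .
  have "(\<lambda>n. (\<gamma> n + a * (1 - \<gamma> n)) * (walk (m n) \<omega> / real (m n) powr c)) \<longlonglongrightarrow> 0"
  proof (rule Lim_null_comparison)
    show "(\<lambda>n. \<bar>walk (m n) \<omega> / real (m n) powr c\<bar>) \<longlonglongrightarrow> 0" using tendsto_rabs_zero[OF W] .
    show "\<forall>\<^sub>F n in sequentially. norm ((\<gamma> n + a * (1 - \<gamma> n)) * (walk (m n) \<omega> / real (m n) powr c))
        \<le> \<bar>walk (m n) \<omega> / real (m n) powr c\<bar>"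
      using eventually_ge_at_top[of 1]
    proof eventually_elim
      case (elim n)
      have \<gamma>: "0 \<le> \<gamma> n" "\<gamma> n \<le> 1" using m[OF elim] by (auto simp: \<gamma>_def divide_le_eq_1)
      have "\<bar>a\<bar> \<le> 1" using p q by (simp add: a_def)
      then have "\<bar>a * (1 - \<gamma> n)\<bar> \<le> 1 * (1 - \<gamma> n)"
        unfolding abs_mult using \<gamma> by (intro mult_mono) auto
      then have "\<bar>\<gamma> n + a * (1 - \<gamma> n)\<bar> \<le> 1"
        using abs_triangle_ineq[of "\<gamma> n" "a * (1 - \<gamma> n)"] \<gamma>(1) by simp
      then show ?case unfolding real_norm_def abs_mult by (rule mult_left_le_one_le[rotated 2]) auto
    qed
  qed
  from tendsto_add[OF this elim(3)]
  have "(\<lambda>n. (\<gamma> n + a * (1 - \<gamma> n)) * (walk (m n) \<omega> / real (m n) powr c)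
      + row_dev n (n - m n) \<omega> / (real n * real (m n) powr (c - 1))) \<longlonglongrightarrow> 0" by simp
  moreover have "\<forall>\<^sub>F n in sequentially. (\<gamma> n + a * (1 - \<gamma> n)) * (walk (m n) \<omega> / real (m n) powr c)
      + row_dev n (n - m n) \<omega> / (real n * real (m n) powr (c - 1))
    = real (m n) / real n * real_of_int (array_walk m X X' n \<omega>) / real (m n) powr c"
    using eventually_ge_at_top[of 1]
  proof eventually_elim
    case (elim n)
    note n = this
    have mn: "0 < real (m n)" "0 < real n" and mn_le: "m n \<le> n" using m[OF n] by auto
    define g where "g = 1 + real (n - m n) * a / real (m n)"
    have "real (m n) / real n * real_of_int (array_walk m X X' n \<omega>) / real (m n) powr c
      = \<gamma> n * g * (walk (m n) \<omega> / real (m n) powr c)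
        + real (m n) / real (m n) powr c * row_dev n (n - m n) \<omega> / real n"
      unfolding T[rule_format, OF n] a_def[symmetric] g_def[symmetric]
      by (simp add: \<gamma>_def algebra_simps add_divide_distrib)
    also have "\<gamma> n * g = \<gamma> n + a * (1 - \<gamma> n)"
      using mn mn_le by (simp add: g_def \<gamma>_def of_nat_diff field_simps)
    also have "real (m n) / real (m n) powr c * row_dev n (n - m n) \<omega> / real n
        = row_dev n (n - m n) \<omega> / (real n * real (m n) powr (c - 1))"
      using mn by (simp add: powr_diff mult_ac)
    finally show ?case by simp
  qed
  ultimately show ?case by (rule Lim_transform_eventually)
qed

end

theorem theorem5p4:
  fixes M :: "'a measure"
    and \<alpha> \<beta> \<gamma> s p q r :: real
    and m :: "nat \<Rightarrow> nat"
    and X \<xi> :: "nat \<Rightarrow> 'a \<Rightarrow> int"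
    and U :: "nat \<Rightarrow> 'a \<Rightarrow> nat"
    and X' \<eta> :: "nat \<Rightarrow> nat \<Rightarrow> 'a \<Rightarrow> int"
    and V :: "nat \<Rightarrow> nat \<Rightarrow> 'a \<Rightarrow> nat"
  assumes "0 < \<beta>" and "\<beta> < 1" and "- \<beta> \<le> \<alpha>" and "\<alpha> \<le> \<beta>"
    and "\<alpha> = p - q" and "\<beta> = 1 - r"
    and "\<And>n. 1 \<le> n \<Longrightarrow> 1 \<le> m n \<and> m n \<le> n"
    and "filterlim m at_top sequentially"
    and "0 \<le> \<gamma>" and "\<gamma> \<le> 1"
    and "(\<lambda>n. real (m n) / real n) \<longlonglongrightarrow> \<gamma>"
    and "erw_stops_array M s p q r m X U \<xi> X' V \<eta>"
  shows "(AE \<omega> in M. (\<lambda>n. real_of_int (array_walk m X X' n \<omega>) / real n) \<longlonglongrightarrow> 0) \<and>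
    (\<forall>c. max \<alpha> (1 / 2) < c \<and> c < 1 \<longrightarrow>
      (AE \<omega> in M. (\<lambda>n. (real (m n) / real n) * real_of_int (array_walk m X X' n \<omega>)
                         / real (m n) powr c) \<longlonglongrightarrow> 0))"
proof -
  interpret erw_stops_array M s p q r m X U \<xi> X' V \<eta> by fact
  have scaled: "AE \<omega> in M. (\<lambda>n. (real (m n) / real n) * real_of_int (array_walk m X X' n \<omega>)
      / real (m n) powr c) \<longlonglongrightarrow> 0" if "max \<alpha> (1 / 2) < c" "c < 1" for c
    using scaled_array_walk_tendsto_0[OF \<open>filterlim m at_top sequentially\<close>] that \<open>\<alpha> = p - q\<close> by simp
  \<comment> \<open>the scaled walk is \<open>m n powr (1 - c)\<close> times \<open>T n / n\<close>, and this factor is at least \<open>1\<close>\<close>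
  moreover have "AE \<omega> in M. (\<lambda>n. real_of_int (array_walk m X X' n \<omega>) / real n) \<longlonglongrightarrow> 0"
  proof -
    have "max \<alpha> (1 / 2) < 1" using \<open>\<alpha> \<le> \<beta>\<close> \<open>\<beta> < 1\<close> by simp
    then obtain c where c: "max \<alpha> (1 / 2) < c" "c < 1" using dense by blast
    from scaled[OF this] show ?thesis
    proof eventually_elim
      case (elim \<omega>)
      show ?case
      proof (rule Lim_null_comparison[OF _ tendsto_rabs_zero[OF elim]])
        show "\<forall>\<^sub>F n in sequentially. norm (real_of_int (array_walk m X X' n \<omega>) / real n)
          \<le> \<bar>real (m n) / real n * real_of_int (array_walk m X X' n \<omega>) / real (m n) powr c\<bar>"
          using eventually_ge_at_top[of 1]
        proof eventually_elim
          case (elim n)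
          have mn: "1 \<le> real (m n)" using m[OF elim] by simp
          have "1 \<le> real (m n) powr (1 - c)" using mn c by (intro ge_one_powr_ge_zero) auto
          then have "1 * \<bar>real_of_int (array_walk m X X' n \<omega>) / real n\<bar>
              \<le> real (m n) powr (1 - c) * \<bar>real_of_int (array_walk m X X' n \<omega>) / real n\<bar>"
            by (intro mult_right_mono) auto
          also have "\<dots> = \<bar>real (m n) / real n * real_of_int (array_walk m X X' n \<omega>) / real (m n) powr c\<bar>"
            using mn by (simp add: powr_diff abs_mult abs_divide)
          finally show ?case by simp
        qed
      qed
    qed
  qed
  ultimately show ?thesis by blast
qed

end
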